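(* The input-output system $x'(t)=Ax(t)+Bu(t)$ on $(0,T)$, $x(0)=0$, $y(t)=Cx(t)$ is approximately output tracking controllable if and only if the triple $(A,B,C)$ satisfies the unique continuation property.
   Context: Fix $T>0$, integers $1\le m\le n$, $1\le p\le n$, and real matrices $A\in\mathbb R^{n\times n}$, $B\in\mathbb R^{n\times m}$, $C\in\mathbb R^{p\times n}$, with $C$ of full row rank. Approximate output tracking controllability: for every $f\in L^2(0,T;\mathbb R^p)$ and every $\varepsilon>0$ there exists a control $u\in L^2(0,T;\mathbb R^m)$ such that the solution $x$ of $x'=Ax+Bu$, $x(0)=0$, satisfies $\|Cx-f\|_{L^2(0,T;\mathbb R^p)}\le\varepsilon$. Unique continuation property of $(A,B,C)$: whenever $g\in L^2(0,T;\mathbb R^p)$ and $\varphi$ is the solution of the adjoint equation $$-\varphi'(t)=A^{\mathsf T}\varphi(t)+C^{\mathsf T}g(t),\quad t\in(0,T),\qquad\varphi(T)=0,$$ the condition $B^{\mathsf T}\varphi(t)=0$ for a.e. $t\in[0,T]$ implies $g\equiv0$. *)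

theory Defs
  imports "HOL-Analysis.Analysis"
begin

text \<open>Elements of \<open>L\<^sup>2(0,T; E)\<close> are represented by functions on the whole real line, of which only
  the restriction to \<open>(0,T)\<close> matters; equality in \<open>L\<^sup>2\<close> is equality almost everywhere there.\<close>

definition L2 :: "real \<Rightarrow> (real \<Rightarrow> 'a::euclidean_space) set" where
  "L2 T = {f. f \<in> borel_measurable (lebesgue_on {0<..<T}) \<and>
              integrable (lebesgue_on {0<..<T}) (\<lambda>t. (norm (f t))\<^sup>2)}"

definition L2_norm :: "real \<Rightarrow> (real \<Rightarrow> 'a::euclidean_space) \<Rightarrow> real" where
  "L2_norm T f = sqrt (LINT t|lebesgue_on {0<..<T}. (norm (f t))\<^sup>2)"

text \<open>Solutions of \<open>x'(t) = F t (x t)\<close> on \<open>(0,T)\<close> in the sense of Caratheodory: \<open>F\<close> is in general only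
  integrable in time, so \<open>x\<close> is an absolutely continuous function with a.e. derivative \<open>F t (x t)\<close>,
  i.e. an indefinite Lebesgue integral of \<open>\<lambda>t. F t (x t)\<close> on \<open>[0,T]\<close>. The initial or terminal
  condition is imposed separately.\<close>

definition solves_on :: "real \<Rightarrow> (real \<Rightarrow> 'a \<Rightarrow> 'a) \<Rightarrow> (real \<Rightarrow> 'a::euclidean_space) \<Rightarrow> bool" where
  "solves_on T F x \<longleftrightarrow>
     set_integrable lebesgue {0..T} (\<lambda>t. F t (x t)) \<and>
     (\<forall>t\<in>{0..T}. x t = x 0 + (LINT s:{0..t}|lebesgue. F s (x s)))"

definition state_trajectory ::
  "real \<Rightarrow> real^'n^'n \<Rightarrow> real^'m^'n \<Rightarrow> (real \<Rightarrow> real^'m) \<Rightarrow> (real \<Rightarrow> real^'n) \<Rightarrow> bool" where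
  "state_trajectory T A B u x \<longleftrightarrow>
     solves_on T (\<lambda>t \<xi>. A *v \<xi> + B *v u t) x \<and> x 0 = 0"

definition adjoint_trajectory ::
  "real \<Rightarrow> real^'n^'n \<Rightarrow> real^'n^'p \<Rightarrow> (real \<Rightarrow> real^'p) \<Rightarrow> (real \<Rightarrow> real^'n) \<Rightarrow> bool" where
  "adjoint_trajectory T A C g \<phi> \<longleftrightarrow>
     solves_on T (\<lambda>t \<xi>. - (transpose A *v \<xi> + transpose C *v g t)) \<phi> \<and> \<phi> T = 0"

definition approx_output_tracking_controllable ::
  "real \<Rightarrow> real^'n^'n \<Rightarrow> real^'m^'n \<Rightarrow> real^'n^'p \<Rightarrow> bool" where
  "approx_output_tracking_controllable T A B C \<longleftrightarrow>
     (\<forall>f\<in>L2 T. \<forall>\<epsilon>>0. \<exists>u\<in>L2 T. \<exists>x. state_trajectory T A B u x \<and>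
        L2_norm T (\<lambda>t. C *v x t - f t) \<le> \<epsilon>)"

definition unique_continuation_property ::
  "real \<Rightarrow> real^'n^'n \<Rightarrow> real^'m^'n \<Rightarrow> real^'n^'p \<Rightarrow> bool" where
  "unique_continuation_property T A B C \<longleftrightarrow>
     (\<forall>g\<in>L2 T. \<forall>\<phi>. adjoint_trajectory T A C g \<phi> \<longrightarrow>
        (AE t in lebesgue_on {0..T}. transpose B *v \<phi> t = 0) \<longrightarrow>
        (AE t in lebesgue_on {0<..<T}. g t = 0))"

end

theory Submission
  imports Defs
begin

text \<open>Let \<open>\<Lambda>\<close> be the linear map from controls \<open>u\<close> to outputs \<open>C x\<close>. Approximate output tracking
controllability says that the range of \<open>\<Lambda>\<close> is dense in \<open>L\<^sup>2(0,T)\<close>. The map \<open>g \<mapsto> B\<^sup>T \<phi>\<close>, where \<open>\<phi>\<close> solves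
the adjoint equation driven by \<open>g\<close>, is the Hilbert space adjoint of \<open>\<Lambda>\<close>
(\<open>input_output_duality\<close>), and unique continuation says that this adjoint is injective. The theorem
is thus the familiar fact that a range is dense if and only if the adjoint has trivial kernel.

One half is elementary: an element of the kernel is orthogonal to all outputs, yet it is approximated
by outputs, so it is zero (\<open>controllable_imp_unique_continuation\<close>). The other half needs the
completeness of \<open>L\<^sup>2\<close>, in the form of the projection onto the closure of a subspace
(\<open>square_integrable_projection\<close>): the part \<open>g\<close> of a target that is orthogonal to all outputs lies in the
kernel of the adjoint, hence vanishes (\<open>unique_continuation_imp_controllable\<close>).

All arguments work with functions and integrals rather than with equivalence classes, and the outputs
form a subspace because trajectories may be superposed (\<open>state_trajectory_lincomb\<close>). The existence of
trajectories comes from Picard iteration for the integrated equation (\<open>linear_volterra_equation_solution\<close>), and the duality from Fubini's theorem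
(\<open>integration_by_parts_indefinite_integrals\<close>), since trajectories are indefinite integrals rather than
differentiable functions.\<close>

section \<open>Orthogonal projection in \<open>L\<^sup>2\<close>\<close>

definition square_integrable :: "'a measure \<Rightarrow> ('a \<Rightarrow> 'b::euclidean_space) \<Rightarrow> bool" where
  "square_integrable M f \<longleftrightarrow> f \<in> borel_measurable M \<and> integrable M (\<lambda>x. (norm (f x))\<^sup>2)"

lemma square_integrable_linear:
  assumes f: "square_integrable M f" and h: "linear h"
  shows "square_integrable M (\<lambda>x. h (f x))"
proof -
  have bl: "bounded_linear h" using h by (simp add: linear_conv_bounded_linear)
  then obtain K where K: "\<And>x. norm (h x) \<le> norm x * K"
    using bounded_linear.bounded by blast
  have m: "(\<lambda>x. h (f x)) \<in> borel_measurable M"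
    using borel_measurable_continuous_onI[OF bounded_linear.continuous_on[OF bl continuous_on_id]] f
    unfolding square_integrable_def by (auto intro: measurable_compose)
  have "integrable M (\<lambda>x. (norm (h (f x)))\<^sup>2)"
  proof (rule Bochner_Integration.integrable_bound)
    show "integrable M (\<lambda>x. K\<^sup>2 * (norm (f x))\<^sup>2)" using f by (simp add: square_integrable_def)
    show "AE x in M. norm ((norm (h (f x)))\<^sup>2) \<le> norm (K\<^sup>2 * (norm (f x))\<^sup>2)"
    proof (rule AE_I2)
      fix x
      have "(norm (h (f x)))\<^sup>2 \<le> (norm (f x) * K)\<^sup>2" by (intro power_mono K) simp
      then show "norm ((norm (h (f x)))\<^sup>2) \<le> norm (K\<^sup>2 * (norm (f x))\<^sup>2)"
        by (simp add: power_mult_distrib mult.commute)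
    qed
  qed (use m in measurable)
  with m show ?thesis by (simp add: square_integrable_def)
qed

lemma square_integrable_scaleR:
  "square_integrable M f \<Longrightarrow> square_integrable M (\<lambda>x. c *\<^sub>R f x)"
  by (rule square_integrable_linear) (auto intro: linear_scaleR)

lemma square_integrable_add:
  assumes "square_integrable M f" "square_integrable M g"
  shows "square_integrable M (\<lambda>x. f x + g x)"
proof -
  have [measurable]: "f \<in> borel_measurable M" "g \<in> borel_measurable M"
    using assms by (auto simp: square_integrable_def)
  have "integrable M (\<lambda>x. (norm (f x + g x))\<^sup>2)"
  proof (rule Bochner_Integration.integrable_bound)
    show "integrable M (\<lambda>x. 2 * (norm (f x))\<^sup>2 + 2 * (norm (g x))\<^sup>2)"
      using assms by (simp add: square_integrable_def)
    show "AE x in M. norm ((norm (f x + g x))\<^sup>2) \<le> norm (2 * (norm (f x))\<^sup>2 + 2 * (norm (g x))\<^sup>2)"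
    proof (rule AE_I2)
      fix x
      have "2 * (norm (f x))\<^sup>2 + 2 * (norm (g x))\<^sup>2 - (norm (f x + g x))\<^sup>2 = (norm (f x - g x))\<^sup>2"
        by (simp add: power2_norm_eq_inner inner_simps inner_commute)
      then have "(norm (f x + g x))\<^sup>2 \<le> 2 * (norm (f x))\<^sup>2 + 2 * (norm (g x))\<^sup>2"
        by (smt (verit) zero_le_power2)
      then show "norm ((norm (f x + g x))\<^sup>2) \<le> norm (2 * (norm (f x))\<^sup>2 + 2 * (norm (g x))\<^sup>2)"
        by simp
    qed
  qed measurable
  then show ?thesis by (simp add: square_integrable_def)
qed

lemma square_integrable_diff:
  assumes "square_integrable M f" "square_integrable M g"
  shows "square_integrable M (\<lambda>x. f x - g x)"
  using square_integrable_add[OF assms(1) square_integrable_scaleR[OF assms(2), of "-1"]] by simp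

lemma integrable_inner_square_integrable:
  assumes "square_integrable M f" "square_integrable M g"
  shows "integrable M (\<lambda>x. f x \<bullet> g x)"
proof -
  have "(\<lambda>x. f x \<bullet> g x) = (\<lambda>x. ((norm (f x + g x))\<^sup>2 - (norm (f x))\<^sup>2 - (norm (g x))\<^sup>2) / 2)"
    by (auto simp: power2_norm_eq_inner inner_simps inner_commute)
  then show ?thesis
    using square_integrable_add[OF assms] assms by (simp add: square_integrable_def)
qed

text \<open>This expansion carries the Hilbert space geometry: the choices \<open>s = 1/2\<close> and \<open>s = -1/2\<close>
give the parallelogram law, \<open>s = -1\<close> gives Pythagoras, and keeping \<open>s\<close> variable gives the first-order
optimality condition of a least-squares problem.\<close>

lemma integral_norm_sq_add:
  assumes "square_integrable M f" "square_integrable M g"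
  shows "(LINT x|M. (norm (f x + s *\<^sub>R g x))\<^sup>2) =
    (LINT x|M. (norm (f x))\<^sup>2) + 2 * s * (LINT x|M. f x \<bullet> g x) + s\<^sup>2 * (LINT x|M. (norm (g x))\<^sup>2)"
proof -
  have "(\<lambda>x. (norm (f x + s *\<^sub>R g x))\<^sup>2) =
      (\<lambda>x. (norm (f x))\<^sup>2 + 2 * s * (f x \<bullet> g x) + s\<^sup>2 * (norm (g x))\<^sup>2)"
    unfolding power2_norm_eq_inner
    by (auto simp: inner_simps inner_commute power2_eq_square[of s] algebra_simps)
  then show ?thesis
    using assms integrable_inner_square_integrable[OF assms] by (simp add: square_integrable_def)
qed

text \<open>An instance of Fatou's lemma. Applied to the differences \<open>v k - v j\<close> of a Cauchy sequence, with \<open>j\<close>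
growing, it both puts the limit into \<open>L\<^sup>2\<close> and bounds the distance of \<open>v k\<close> to it.\<close>

lemma square_integrable_AE_limit:
  assumes v: "v \<in> borel_measurable M"
    and int: "\<And>j. square_integrable M (u j)"
    and lim: "AE x in M. (\<lambda>j. u j x) \<longlonglongrightarrow> v x"
    and bd: "eventually (\<lambda>j. (LINT x|M. (norm (u j x))\<^sup>2) \<le> c) sequentially"
  shows "square_integrable M v \<and> (LINT x|M. (norm (v x))\<^sup>2) \<le> c"
proof -
  note [measurable] = v
  have [measurable]: "u j \<in> borel_measurable M" for j using int by (simp add: square_integrable_def)
  have c0: "0 \<le> c"
  proof -
    obtain j where "(LINT x|M. (norm (u j x))\<^sup>2) \<le> c"
      using bd unfolding eventually_sequentially by blast
    moreover have "0 \<le> (LINT x|M. (norm (u j x))\<^sup>2)" by (intro integral_nonneg_AE) auto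
    ultimately show ?thesis by linarith
  qed
  have "(\<integral>\<^sup>+x. ennreal ((norm (v x))\<^sup>2) \<partial>M) = (\<integral>\<^sup>+x. liminf (\<lambda>j. ennreal ((norm (u j x))\<^sup>2)) \<partial>M)"
  proof (rule nn_integral_cong_AE, rule AE_mp[OF lim], rule AE_I2, rule impI)
    fix x assume "(\<lambda>j. u j x) \<longlonglongrightarrow> v x"
    then have "(\<lambda>j. ennreal ((norm (u j x))\<^sup>2)) \<longlonglongrightarrow> ennreal ((norm (v x))\<^sup>2)"
      by (intro tendsto_intros) auto
    then show "ennreal ((norm (v x))\<^sup>2) = liminf (\<lambda>j. ennreal ((norm (u j x))\<^sup>2))"
      by (rule lim_imp_Liminf[OF sequentially_bot, symmetric])
  qed
  also have "\<dots> \<le> liminf (\<lambda>j. \<integral>\<^sup>+x. ennreal ((norm (u j x))\<^sup>2) \<partial>M)"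
    by (rule nn_integral_liminf) measurable
  also have "\<dots> = liminf (\<lambda>j. ennreal (LINT x|M. (norm (u j x))\<^sup>2))"
    using int by (subst nn_integral_eq_integral) (auto simp: square_integrable_def)
  also have "\<dots> \<le> limsup (\<lambda>j. ennreal (LINT x|M. (norm (u j x))\<^sup>2))"
    by (rule Liminf_le_Limsup) simp
  also have "\<dots> \<le> ennreal c"
    using bd by (intro Limsup_bounded) (auto elim!: eventually_mono intro: ennreal_leI)
  finally have le: "(\<integral>\<^sup>+x. ennreal ((norm (v x))\<^sup>2) \<partial>M) \<le> ennreal c" .
  then have i: "integrable M (\<lambda>x. (norm (v x))\<^sup>2)"
    by (intro integrableI_bounded) (auto simp: le_less_trans)
  have "ennreal (LINT x|M. (norm (v x))\<^sup>2) \<le> ennreal c"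
    using le i by (subst nn_integral_eq_integral[symmetric]) auto
  with i c0 show ?thesis by (simp add: square_integrable_def)
qed

lemma AE_summable_of_summable_integrals:
  fixes f :: "nat \<Rightarrow> 'a \<Rightarrow> real"
  assumes f: "\<And>k. integrable M (f k)" and pos: "\<And>k x. 0 \<le> f k x"
    and s: "summable (\<lambda>k. LINT x|M. f k x)"
  shows "AE x in M. summable (\<lambda>k. f k x)"
proof -
  have [measurable]: "\<And>k. f k \<in> borel_measurable M" using f by auto
  have "(\<integral>\<^sup>+x. (\<Sum>k. ennreal (f k x)) \<partial>M) = (\<Sum>k. \<integral>\<^sup>+x. ennreal (f k x) \<partial>M)"
    by (rule nn_integral_suminf) measurable
  also have "\<dots> = (\<Sum>k. ennreal (LINT x|M. f k x))"
    using f pos by (subst nn_integral_eq_integral) auto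
  also have "\<dots> = ennreal (\<Sum>k. LINT x|M. f k x)"
    using s pos by (intro suminf_ennreal2) auto
  finally have "(\<integral>\<^sup>+x. (\<Sum>k. ennreal (f k x)) \<partial>M) \<noteq> \<infinity>" by simp
  then have "AE x in M. (\<Sum>k. ennreal (f k x)) \<noteq> \<infinity>"
    by (intro nn_integral_PInf_AE) measurable
  then show ?thesis
    by (rule AE_mp) (use pos in \<open>auto intro!: AE_I2 summable_suminf_not_top\<close>)
qed

text \<open>The core of the Riesz-Fischer theorem. On a finite measure space the \<open>L\<^sup>2\<close> bounds on the
increments yield summable \<open>L\<^sup>1\<close> bounds, so almost everywhere the increments form an absolutely
convergent series, whose partial sums telescope.\<close>

lemma (in finite_measure) AE_convergent_of_fast_Cauchy:
  fixes v :: "nat \<Rightarrow> 'a \<Rightarrow> 'b::euclidean_space"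
  assumes v: "\<And>k. square_integrable M (v k)"
    and fast: "\<And>k. (LINT x|M. (norm (v (Suc k) x - v k x))\<^sup>2) \<le> c * (1/4)^k"
  obtains w where "w \<in> borel_measurable M" "AE x in M. (\<lambda>k. v k x) \<longlonglongrightarrow> w x"
proof -
  have [measurable]: "v k \<in> borel_measurable M" for k using v by (simp add: square_integrable_def)
  define D where "D k x = norm (v (Suc k) x - v k x)" for k x
  have D2: "integrable M (\<lambda>x. (D k x)\<^sup>2)" for k
    using square_integrable_diff[OF v v] by (simp add: D_def square_integrable_def)
  have [measurable]: "D k \<in> borel_measurable M" for k unfolding D_def by measurable
  \<comment> \<open>Young's inequality; the weight \<open>2 ^ k\<close> makes the integrals of both terms decay like \<open>(1/2) ^ k\<close>.\<close>
  have young: "D k x \<le> (1/2)^k + 2^k * (D k x)\<^sup>2" for k x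
  proof -
    have "0 \<le> (2^k * D k x - 1)\<^sup>2 + 2^k * D k x" by (simp add: D_def)
    then have "2^k * D k x \<le> 1 + (2^k * D k x)\<^sup>2" by (simp add: power2_eq_square algebra_simps)
    then have "(1/2)^k * (2^k * D k x) \<le> (1/2)^k * (1 + (2^k * D k x)\<^sup>2)"
      by (intro mult_left_mono) auto
    also have "(1/2)^k * (1 + (2^k * D k x)\<^sup>2) = (1/2)^k + 2^k * (D k x)\<^sup>2"
      by (simp add: power_mult_distrib distrib_left power_one_over field_simps power2_eq_square)
    finally show ?thesis by (simp add: power_one_over)
  qed
  have D1: "integrable M (D k)" for k
  proof (rule Bochner_Integration.integrable_bound)
    show "integrable M (\<lambda>x. (1/2)^k + 2^k * (D k x)\<^sup>2)" using D2 by simp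
    show "AE x in M. norm (D k x) \<le> norm ((1/2)^k + 2^k * (D k x)\<^sup>2)"
      using young[of k] by (auto intro!: AE_I2 simp: D_def)
  qed measurable
  have bound: "(LINT x|M. D k x) \<le> (measure M (space M) + c) * (1/2)^k" for k
  proof -
    have "(LINT x|M. D k x) \<le> (LINT x|M. (1/2)^k + 2^k * (D k x)\<^sup>2)"
      using D1 D2 young by (intro integral_mono) auto
    also have "\<dots> = (1/2)^k * measure M (space M) + 2^k * (LINT x|M. (D k x)\<^sup>2)"
      using D2 by simp
    also have "\<dots> \<le> (1/2)^k * measure M (space M) + 2^k * (c * (1/4)^k)"
      using fast[of k] unfolding D_def by simp
    also have "2^k * (c * (1/4)^k) = c * (1/2::real)^k"
      by (simp add: power_mult_distrib[symmetric])
    finally show ?thesis by (simp add: algebra_simps)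
  qed
  have "summable (\<lambda>k. LINT x|M. D k x)"
  proof (rule summable_comparison_test')
    show "summable (\<lambda>k. (measure M (space M) + c) * (1/2)^k)"
      by (intro summable_mult summable_geometric) auto
    show "norm (LINT x|M. D k x) \<le> (measure M (space M) + c) * (1/2)^k" if "k \<ge> 0" for k
      using bound[of k] by (simp add: D_def)
  qed
  then have sm: "AE x in M. summable (\<lambda>k. D k x)"
    by (intro AE_summable_of_summable_integrals D1) (auto simp: D_def)
  show ?thesis
  proof
    show "(\<lambda>x. lim (\<lambda>k. v k x)) \<in> borel_measurable M" by measurable
    show "AE x in M. (\<lambda>k. v k x) \<longlonglongrightarrow> lim (\<lambda>k. v k x)"
    proof (rule AE_mp[OF sm], rule AE_I2, rule impI)
      fix x assume "summable (\<lambda>k. D k x)"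
      then have "summable (\<lambda>k. v (Suc k) x - v k x)"
        unfolding D_def by (rule summable_norm_cancel)
      then have "convergent (\<lambda>n. \<Sum>k<n. v (Suc k) x - v k x)" by (simp add: summable_iff_convergent)
      then have "convergent (\<lambda>n. (v n x - v 0 x) + v 0 x)"
        unfolding sum_lessThan_telescope[of "\<lambda>k. v k x"] by (intro convergent_add convergent_const)
      then show "(\<lambda>k. v k x) \<longlonglongrightarrow> lim (\<lambda>k. v k x)" by (simp add: convergent_LIMSEQ_iff)
    qed
  qed
qed

text \<open>Orthogonal projection of \<open>f\<close> onto the closure of the subspace \<open>V\<close>. Elements of \<open>V\<close> whose distance
to \<open>f\<close> approaches the infimum form a Cauchy sequence by the parallelogram law, and their limit \<open>w\<close> is
the projection. The point \<open>w\<close> need not lie in \<open>V\<close>; it is only approximated by elements of \<open>V\<close>, which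
is all that density arguments ask for.\<close>

proposition (in finite_measure) square_integrable_projection:
  fixes V :: "('a \<Rightarrow> 'b::euclidean_space) set"
  assumes V: "\<And>v. v \<in> V \<Longrightarrow> square_integrable M v" and zero: "(\<lambda>_. 0) \<in> V"
    and add: "\<And>v w. v \<in> V \<Longrightarrow> w \<in> V \<Longrightarrow> (\<lambda>x. v x + w x) \<in> V"
    and scale: "\<And>c v. v \<in> V \<Longrightarrow> (\<lambda>x. c *\<^sub>R v x) \<in> V"
    and f: "square_integrable M f"
  obtains w where "square_integrable M w" "\<And>v. v \<in> V \<Longrightarrow> (LINT x|M. (f x - w x) \<bullet> v x) = 0"
    "\<And>e. e > 0 \<Longrightarrow> \<exists>v\<in>V. (LINT x|M. (norm (v x - w x))\<^sup>2) \<le> e"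
proof -
  define Q where "Q h = (LINT x|M. (norm (h x))\<^sup>2)" for h :: "'a \<Rightarrow> 'b"
  have Q0: "0 \<le> Q h" for h unfolding Q_def by (intro integral_nonneg_AE) auto
  define d where "d = (INF v\<in>V. Q (\<lambda>x. f x - v x))"
  have bb: "bdd_below ((\<lambda>v. Q (\<lambda>x. f x - v x)) ` V)" using Q0 by (auto intro!: bdd_belowI)
  have d: "d \<le> Q (\<lambda>x. f x - v x)" if "v \<in> V" for v
    unfolding d_def using bb that by (rule cINF_lower)
  have "\<exists>v\<in>V. Q (\<lambda>x. f x - v x) < d + (1/4)^k" for k :: nat
    using cInf_lessD[of "(\<lambda>v. Q (\<lambda>x. f x - v x)) ` V" "d + (1/4)^k"] zero
    unfolding d_def by fastforce
  then obtain v where vV: "\<And>k. v k \<in> V" and vQ: "\<And>k. Q (\<lambda>x. f x - v k x) < d + (1/4)^k"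
    by metis
  have sv: "square_integrable M (v k)" for k using vV V by blast
  have [measurable]: "v k \<in> borel_measurable M" for k using sv by (simp add: square_integrable_def)
  have cauchy: "Q (\<lambda>x. v j x - v k x) \<le> 4 * (1/4)^k" if "k \<le> j" for j k
  proof -
    define m where "m = (\<lambda>x. (1/2) *\<^sub>R (v j x + v k x))"
    have mV: "m \<in> V" unfolding m_def by (intro scale add vV)
    let ?a = "\<lambda>x. f x - m x" and ?b = "\<lambda>x. v j x - v k x"
    have s: "square_integrable M ?a" "square_integrable M ?b"
      using V[OF mV] by (auto intro!: square_integrable_diff f sv)
    have eq: "?a x + (1/2) *\<^sub>R ?b x = f x - v k x" "?a x + (-1/2) *\<^sub>R ?b x = f x - v j x" for x
      by (auto simp: m_def algebra_simps simp flip: scaleR_add_left)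
    have "Q (\<lambda>x. f x - v k x) + Q (\<lambda>x. f x - v j x) = 2 * Q ?a + Q ?b / 2"
      using integral_norm_sq_add[OF s, of "1/2"] integral_norm_sq_add[OF s, of "-1/2"]
      unfolding eq Q_def by (simp add: power2_eq_square)
    moreover have "d \<le> Q ?a" using d mV by blast
    moreover have "(1/4::real)^j \<le> (1/4)^k" using that by (intro power_decreasing) auto
    ultimately show ?thesis using vQ[of k] vQ[of j] by linarith
  qed
  have "(LINT x|M. (norm (v (Suc k) x - v k x))\<^sup>2) \<le> 4 * (1/4)^k" for k
    using cauchy[of k "Suc k"] by (simp add: Q_def)
  then obtain w where w[measurable]: "w \<in> borel_measurable M"
    and lim: "AE x in M. (\<lambda>k. v k x) \<longlonglongrightarrow> w x"
    by (rule AE_convergent_of_fast_Cauchy[OF sv])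
  have near: "square_integrable M (\<lambda>x. v k x - w x) \<and> Q (\<lambda>x. v k x - w x) \<le> 4 * (1/4)^k" for k
    unfolding Q_def
  proof (rule square_integrable_AE_limit[where u = "\<lambda>j x. v k x - v j x"])
    show "AE x in M. (\<lambda>j. v k x - v j x) \<longlonglongrightarrow> v k x - w x"
      using lim by eventually_elim (intro tendsto_intros)
    show "\<forall>\<^sub>F j in sequentially. (LINT x|M. (norm (v k x - v j x))\<^sup>2) \<le> 4 * (1/4)^k"
      using eventually_ge_at_top[of k]
      by eventually_elim (use cauchy[of k] in \<open>simp add: Q_def norm_minus_commute\<close>)
  qed (auto intro: square_integrable_diff sv)
  have sw: "square_integrable M w"
    using square_integrable_diff[OF sv[of 0] conjunct1[OF near[of 0]]] by simp
  have pow0: "(\<lambda>k. (1/4::real)^k) \<longlonglongrightarrow> 0" by (rule LIMSEQ_realpow_zero) auto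
  show ?thesis
  proof
    show "square_integrable M w" by (rule sw)
    show "\<exists>v\<in>V. (LINT x|M. (norm (v x - w x))\<^sup>2) \<le> e" if "e > 0" for e
    proof -
      have "\<forall>\<^sub>F k in sequentially. (1/4::real)^k < e / 4"
        using order_tendstoD(2)[OF pow0, of "e/4"] that by simp
      then obtain k where k: "(1/4::real)^k < e / 4" by (auto simp: eventually_sequentially)
      show ?thesis using near[of k] k vV[of k] unfolding Q_def by (intro bexI[of _ "v k"]) auto
    qed
  next
    fix z assume zV: "z \<in> V"
    let ?g = "\<lambda>x. f x - w x"
    define I where "I = (LINT x|M. ?g x \<bullet> z x)"
    have sz: "square_integrable M z" using V zV by blast
    \<comment> \<open>The almost minimality of \<open>v k\<close> controls the component of \<open>f - v k\<close> along \<open>z\<close>, and the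
      closeness of \<open>v k\<close> to \<open>w\<close> controls that of \<open>v k - w\<close>; both errors vanish as \<open>k\<close> grows.\<close>
    have step: "2 * s * I \<le> 5 * (1/4)^k + 2 * s\<^sup>2 * Q z" for s k
    proof -
      let ?a = "\<lambda>x. f x - v k x" and ?b = "\<lambda>x. v k x - w x"
      have sa: "square_integrable M ?a" and sb: "square_integrable M ?b"
        using near[of k] by (auto intro!: square_integrable_diff f sv)
      have "d \<le> Q (\<lambda>x. ?a x + (-s) *\<^sub>R z x)"
        using d[OF add[OF vV[of k] scale[OF zV, of s]]] by (simp add: algebra_simps)
      also have "\<dots> = Q ?a - 2 * s * (LINT x|M. ?a x \<bullet> z x) + s\<^sup>2 * Q z"
        using integral_norm_sq_add[OF sa sz, of "-s"] by (simp add: Q_def)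
      finally have 1: "2 * s * (LINT x|M. ?a x \<bullet> z x) \<le> (1/4)^k + s\<^sup>2 * Q z"
        using vQ[of k] by linarith
      have "0 \<le> Q (\<lambda>x. ?b x + (-s) *\<^sub>R z x)" by (rule Q0)
      also have "\<dots> = Q ?b - 2 * s * (LINT x|M. ?b x \<bullet> z x) + s\<^sup>2 * Q z"
        using integral_norm_sq_add[OF sb sz, of "-s"] by (simp add: Q_def)
      finally have 2: "2 * s * (LINT x|M. ?b x \<bullet> z x) \<le> 4 * (1/4)^k + s\<^sup>2 * Q z"
        using near[of k] by linarith
      have "I = (LINT x|M. ?a x \<bullet> z x + ?b x \<bullet> z x)"
        unfolding I_def by (intro Bochner_Integration.integral_cong) (auto simp: inner_simps)
      also have "\<dots> = (LINT x|M. ?a x \<bullet> z x) + (LINT x|M. ?b x \<bullet> z x)"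
        using sa sb sz by (intro Bochner_Integration.integral_add integrable_inner_square_integrable)
      finally show ?thesis using 1 2 by (simp add: distrib_left)
    qed
    have step2: "2 * s * I \<le> 2 * s\<^sup>2 * Q z" for s
    proof -
      have "(\<lambda>k. 5 * (1/4::real)^k + 2 * s\<^sup>2 * Q z) \<longlonglongrightarrow> 5 * 0 + 2 * s\<^sup>2 * Q z"
        by (intro tendsto_intros pow0)
      then show ?thesis using step[of s] by (intro LIMSEQ_le_const) auto
    qed
    \<comment> \<open>The bound is quadratic in \<open>s\<close> on the right but only linear on the left, which forces \<open>I = 0\<close>.
      Here \<open>s = I / p\<close> exhibits this; adding \<open>1\<close> to \<open>Q z\<close> avoids a division by zero.\<close>
    define p where "p = Q z + 1"
    have p: "p > 0" using Q0[of z] unfolding p_def by linarith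
    have "2 * (I / p) * I * (p\<^sup>2 / 2) \<le> 2 * (I / p)\<^sup>2 * Q z * (p\<^sup>2 / 2)"
      by (intro mult_right_mono step2) simp
    moreover have "2 * (I / p) * I * (p\<^sup>2 / 2) = I\<^sup>2 * Q z + I\<^sup>2"
      using p by (simp add: power2_eq_square) (simp add: p_def algebra_simps)
    moreover have "2 * (I / p)\<^sup>2 * Q z * (p\<^sup>2 / 2) = I\<^sup>2 * Q z"
      using p by (simp add: power_divide)
    ultimately have "I\<^sup>2 \<le> 0" by linarith
    then show "(LINT x|M. (f x - w x) \<bullet> z x) = 0" by (simp add: I_def)
  qed
qed

section \<open>Linear differential equations with integrable forcing\<close>

text \<open>Picard iteration, summed as a Neumann series: with \<open>d 0 = H\<close> and \<open>d (Suc k)\<close> the integral of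
\<open>L \<circ> d k\<close>, the sum of all \<open>d k\<close> solves the equation. Working with the integrated equation keeps every
function continuous even when the forcing term of the differential equation is merely integrable,
because that term enters only through its primitive \<open>H\<close>.\<close>

lemma linear_volterra_equation_solution:
  fixes L :: "'a::euclidean_space \<Rightarrow> 'a" and H :: "real \<Rightarrow> 'a"
  assumes L: "bounded_linear L" and H: "continuous_on {0..T} H"
  obtains x where "continuous_on {0..T} x"
    "\<And>t. t \<in> {0..T} \<Longrightarrow> x t = H t + integral {0..t} (\<lambda>s. L (x s))"
proof -
  obtain K where K: "K > 0" "\<And>y. norm (L y) \<le> norm y * K"
    using bounded_linear.pos_bounded[OF L] by blast
  obtain m where m: "m > 0" "\<And>t. t \<in> {0..T} \<Longrightarrow> norm (H t) \<le> m"
    using compact_imp_bounded[OF compact_continuous_image[OF H compact_Icc]]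
    unfolding bounded_pos by auto
  define d where "d = rec_nat H (\<lambda>_ z t. integral {0..t} (\<lambda>s. L (z s)))"
  have d0: "d 0 = H" and dS: "d (Suc k) = (\<lambda>t. integral {0..t} (\<lambda>s. L (d k s)))" for k
    by (simp_all add: d_def)
  have cL: "continuous_on S (\<lambda>s. L (z s))" if "continuous_on S z" for S :: "real set" and z
    using bounded_linear.continuous_on[OF L that] .
  have cd: "continuous_on {0..T} (d k)" for k
  proof (induction k)
    case (Suc k)
    show ?case unfolding dS
      by (intro indefinite_integral_continuous_1 integrable_continuous_interval cL Suc)
  qed (simp add: d0 H)
  \<comment> \<open>Relative to the weight \<open>exp (2 * K * t)\<close>, each Picard step contracts by the factor \<open>1/2\<close>,
    so the series converges on the whole interval, however large \<open>T\<close> is.\<close>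
  have bd: "norm (d k t) \<le> m * (1/2)^k * exp (2 * K * t)" if "t \<in> {0..T}" for k t
    using that
  proof (induction k arbitrary: t)
    case 0
    have "norm (H t) \<le> m * 1" using m(2)[OF 0] by simp
    also have "\<dots> \<le> m * exp (2 * K * t)"
      using m(1) K(1) 0 by (intro mult_left_mono) auto
    finally show ?case by (simp add: d0)
  next
    case (Suc k)
    let ?c = "m * (1/2)^k * K"
    have int: "((\<lambda>s. ?c * exp (2 * K * s)) has_integral
        m * (1/2)^Suc k * exp (2 * K * t) - m * (1/2)^Suc k * exp (2 * K * 0)) {0..t}"
      using Suc.prems
      by (intro fundamental_theorem_of_calculus)
        (auto intro!: derivative_eq_intros simp flip: has_real_derivative_iff_has_vector_derivative)
    have "norm (integral {0..t} (\<lambda>s. L (d k s))) \<le> integral {0..t} (\<lambda>s. ?c * exp (2 * K * s))"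
    proof (rule integral_norm_bound_integral)
      have "continuous_on {0..t} (d k)"
        using Suc.prems by (intro continuous_on_subset[OF cd]) auto
      then show "(\<lambda>s. L (d k s)) integrable_on {0..t}"
        by (intro integrable_continuous_interval cL)
      show "(\<lambda>s. ?c * exp (2 * K * s)) integrable_on {0..t}" using int by blast
      fix s assume "s \<in> {0..t}"
      then have s: "s \<in> {0..T}" using Suc.prems by auto
      have "norm (L (d k s)) \<le> norm (d k s) * K" by (rule K)
      also have "\<dots> \<le> (m * (1/2)^k * exp (2 * K * s)) * K"
        using K(1) by (intro mult_right_mono Suc.IH s) auto
      finally show "norm (L (d k s)) \<le> ?c * exp (2 * K * s)" by (simp add: ac_simps)
    qed
    also have "\<dots> \<le> m * (1/2)^Suc k * exp (2 * K * t)"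
      using integral_unique[OF int] m(1) by simp
    finally show ?case by (simp add: dS)
  qed
  define S where "S n t = (\<Sum>k<n. d k t)" for n t
  define x where "x t = (\<Sum>k. d k t)" for t
  have ul: "uniform_limit {0..T} S x sequentially"
    unfolding S_def x_def
  proof (rule Weierstrass_m_test)
    show "norm (d k t) \<le> m * exp (2 * K * T) * (1/2)^k" if "t \<in> {0..T}" for k t
    proof -
      have "m * (1/2)^k * exp (2 * K * t) \<le> m * (1/2)^k * exp (2 * K * T)"
        using that m(1) K(1) by (intro mult_left_mono) auto
      with bd[OF that, of k] show ?thesis by (simp add: ac_simps)
    qed
    show "summable (\<lambda>k. m * exp (2 * K * T) * (1/2)^k)"
      by (intro summable_mult summable_geometric) auto
  qed
  have cS: "continuous_on {0..T} (S n)" for n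
    unfolding S_def by (intro continuous_intros cd)
  show ?thesis
  proof
    show "continuous_on {0..T} x"
      by (rule uniform_limit_theorem[OF always_eventually ul]) (simp_all add: cS)
    fix t assume t: "t \<in> {0..T}"
    then have sub: "{0..t} \<subseteq> {0..T}" by auto
    have "uniform_limit {0..t} (\<lambda>n s. L (S n s)) (\<lambda>s. L (x s)) sequentially"
      by (rule bounded_linear.uniform_limit[OF L uniform_limit_on_subset[OF ul sub]])
    then obtain I J where I: "\<And>n. ((\<lambda>s. L (S n s)) has_integral I n) {0..t}"
      and J: "((\<lambda>s. L (x s)) has_integral J) {0..t}" and IJ: "I \<longlonglongrightarrow> J"
      by (rule uniform_limit_integral) (auto intro: cL continuous_on_subset[OF cS sub])
    have rec: "S (Suc n) t = H t + I n" for n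
    proof -
      have "I n = integral {0..t} (\<lambda>s. \<Sum>k<n. L (d k s))"
        using integral_unique[OF I[of n]] unfolding S_def by (simp add: linear_sum[OF bounded_linear.linear[OF L]])
      also have "\<dots> = (\<Sum>k<n. d (Suc k) t)"
        unfolding dS
        by (intro integral_sum integrable_continuous_interval cL continuous_on_subset[OF cd sub]) auto
      finally show ?thesis unfolding S_def by (simp add: sum.lessThan_Suc_shift d0 del: sum.lessThan_Suc)
    qed
    have "(\<lambda>n. S (Suc n) t) \<longlonglongrightarrow> x t"
      using tendsto_uniform_limitI[OF ul t] by (rule LIMSEQ_Suc)
    moreover have "(\<lambda>n. S (Suc n) t) \<longlonglongrightarrow> H t + J"
      unfolding rec by (intro tendsto_intros IJ)
    ultimately show "x t = H t + integral {0..t} (\<lambda>s. L (x s))"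
      using J by (metis LIMSEQ_unique integral_unique)
  qed
qed

lemma solves_on_iff:
  "solves_on T F x \<longleftrightarrow> (\<lambda>t. F t (x t)) absolutely_integrable_on {0..T} \<and>
     (\<forall>t\<in>{0..T}. x t = x 0 + integral {0..t} (\<lambda>s. F s (x s)))"
proof -
  have "(LINT s:{0..t}|lebesgue. F s (x s)) = integral {0..t} (\<lambda>s. F s (x s))"
    if "(\<lambda>t. F t (x t)) absolutely_integrable_on {0..T}" "t \<in> {0..T}" for t
    using that by (intro set_lebesgue_integral_eq_integral set_integrable_subset[OF that(1)]) auto
  then show ?thesis unfolding solves_on_def by auto
qed

lemma solves_on_continuous:
  assumes "solves_on T F x"
  shows "continuous_on {0..T} x"
proof -
  have "continuous_on {0..T} (\<lambda>t. x 0 + integral {0..t} (\<lambda>s. F s (x s)))"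
    using assms unfolding solves_on_iff absolutely_integrable_on_def
    by (intro continuous_intros indefinite_integral_continuous_1) auto
  then show ?thesis
    by (rule continuous_on_eq) (metis assms solves_on_iff)
qed

lemma initial_value_problem_solution:
  fixes L :: "'a::euclidean_space \<Rightarrow> 'a" and h :: "real \<Rightarrow> 'a"
  assumes T: "0 \<le> T" and L: "bounded_linear L" and h: "h absolutely_integrable_on {0..T}"
  obtains x where "solves_on T (\<lambda>t \<xi>. L \<xi> + h t) x" "x 0 = 0"
proof -
  have hi: "h integrable_on {0..T}" using h by (simp add: absolutely_integrable_on_def)
  obtain x where c: "continuous_on {0..T} x"
    and x: "\<And>t. t \<in> {0..T} \<Longrightarrow> x t = integral {0..t} h + integral {0..t} (\<lambda>s. L (x s))"
    using linear_volterra_equation_solution[OF L indefinite_integral_continuous_1[OF hi]] by blast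
  have cL: "continuous_on {0..T} (\<lambda>s. L (x s))" by (rule bounded_linear.continuous_on[OF L c])
  have x0: "x 0 = 0" using x[of 0] T by simp
  have "solves_on T (\<lambda>t \<xi>. L \<xi> + h t) x"
    unfolding solves_on_iff
  proof (intro conjI ballI)
    show "(\<lambda>t. L (x t) + h t) absolutely_integrable_on {0..T}"
      by (intro set_integral_add(1) absolutely_integrable_continuous_real cL h)
    fix t assume t: "t \<in> {0..T}"
    have "(\<lambda>s. L (x s)) integrable_on {0..t}"
      by (rule integrable_continuous_interval, rule continuous_on_subset[OF cL]) (use t in auto)
    moreover have "h integrable_on {0..t}"
      by (rule integrable_subinterval_real[OF hi]) (use t in auto)
    ultimately show "x t = x 0 + integral {0..t} (\<lambda>s. L (x s) + h s)"
      using x[OF t] x0 by (simp add: integral_add)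
  qed
  with x0 show ?thesis using that by blast
qed

text \<open>Reversal of time turns this into an integral equation with initial point \<open>0\<close>. The reversal is
applied after integration, so that the change of variables concerns a continuous integrand only and
\<open>h\<close> itself is never reflected.\<close>

lemma terminal_value_problem_solution:
  fixes L :: "'a::euclidean_space \<Rightarrow> 'a" and h :: "real \<Rightarrow> 'a"
  assumes T: "0 \<le> T" and L: "bounded_linear L" and h: "h absolutely_integrable_on {0..T}"
  obtains \<phi> where "solves_on T (\<lambda>t \<xi>. - (L \<xi> + h t)) \<phi>" "\<phi> T = 0"
proof -
  have hi: "h integrable_on {0..T}" using h by (simp add: absolutely_integrable_on_def)
  have "continuous_on {0..T} (\<lambda>t. integral {T - t..T} h)"
    by (rule continuous_on_compose2[OF indefinite_integral_continuous_1'[OF hi]])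
      (auto intro!: continuous_intros)
  then obtain y where c: "continuous_on {0..T} y"
    and y: "\<And>t. t \<in> {0..T} \<Longrightarrow> y t = integral {T - t..T} h + integral {0..t} (\<lambda>s. L (y s))"
    by (rule linear_volterra_equation_solution[OF L]) blast
  define \<phi> where "\<phi> t = y (T - t)" for t
  have cphi: "continuous_on {0..T} \<phi>"
    unfolding \<phi>_def by (rule continuous_on_compose2[OF c]) (auto intro!: continuous_intros)
  have cL: "continuous_on {0..T} (\<lambda>s. L (\<phi> s))" by (rule bounded_linear.continuous_on[OF L cphi])
  have ab: "(\<lambda>t. L (\<phi> t) + h t) absolutely_integrable_on {0..T}"
    by (intro set_integral_add(1) absolutely_integrable_continuous_real cL h)
  then have i: "(\<lambda>t. L (\<phi> t) + h t) integrable_on {0..T}"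
    by (simp add: absolutely_integrable_on_def)
  have phi: "\<phi> t = integral {t..T} (\<lambda>s. L (\<phi> s) + h s)" if t: "t \<in> {0..T}" for t
  proof -
    have "((\<lambda>s. L (y s)) has_integral integral {0..T - t} (\<lambda>s. L (y s))) (cbox 0 (T - t))"
      using t by (auto intro!: integrable_integral integrable_continuous_interval
          bounded_linear.continuous_on[OF L] continuous_on_subset[OF c])
    from has_integral_affinity[OF this, of "-1" T]
    have "((\<lambda>s. L (\<phi> s)) has_integral integral {0..T - t} (\<lambda>s. L (y s)))
        ((\<lambda>s. - s + T) ` {0..T - t})" by (simp add: \<phi>_def)
    also have "(\<lambda>s. - s + T) ` {0..T - t} = {t..T}"
      using image_affinity_atLeastAtMost[of "-1" T 0 "T - t"] t by simp
    finally have "integral {t..T} (\<lambda>s. L (\<phi> s)) = integral {0..T - t} (\<lambda>s. L (y s))"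
      by (rule integral_unique)
    moreover have "(\<lambda>s. L (\<phi> s)) integrable_on {t..T}"
      by (rule integrable_continuous_interval, rule continuous_on_subset[OF cL]) (use t in auto)
    moreover have "h integrable_on {t..T}"
      by (rule integrable_subinterval_real[OF hi]) (use t in auto)
    ultimately show ?thesis using y[of "T - t"] t by (simp add: \<phi>_def integral_add)
  qed
  have "solves_on T (\<lambda>t \<xi>. - (L \<xi> + h t)) \<phi>"
    unfolding solves_on_iff
  proof (intro conjI ballI)
    show "(\<lambda>t. - (L (\<phi> t) + h t)) absolutely_integrable_on {0..T}"
      using ab unfolding set_integrable_def scaleR_minus_right by (rule Bochner_Integration.integrable_minus)
    fix t assume t: "t \<in> {0..T}"
    show "\<phi> t = \<phi> 0 + integral {0..t} (\<lambda>s. - (L (\<phi> s) + h s))"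
    proof -
      let ?F = "\<lambda>s. L (\<phi> s) + h s"
      have "integral {0..t} ?F + integral {t..T} ?F = integral {0..T} ?F"
        using t by (intro Henstock_Kurzweil_Integration.integral_combine i) auto
      moreover have "\<phi> 0 = integral {0..T} ?F" using phi[of 0] T by simp
      ultimately have "integral {0..t} ?F + \<phi> t = \<phi> 0" using phi[OF t] by metis
      moreover have "c = x + - b" if "b + c = x" for b c x :: 'a using that by auto
      ultimately have "\<phi> t = \<phi> 0 + - integral {0..t} ?F" by blast
      then show ?thesis by (simp only: integral_neg)
    qed
  qed
  moreover have "\<phi> T = 0" using phi[of T] T by simp
  ultimately show ?thesis using that by blast
qed

section \<open>Duality between inputs and outputs\<close>

text \<open>Both sides are iterated integrals of \<open>a t \<bullet> b s\<close> over the triangle \<open>t \<le> s\<close>, so this is Fubini's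
theorem. The boundary terms of the usual formula are absent because the first primitive vanishes at
\<open>0\<close> and the second one at \<open>T\<close>.\<close>

lemma integration_by_parts_indefinite_integrals:
  fixes a b :: "real \<Rightarrow> 'a::euclidean_space"
  assumes a: "a absolutely_integrable_on {0..T}" and b: "b absolutely_integrable_on {0..T}"
  shows "(LINT s|lebesgue_on {0..T}. integral {0..s} a \<bullet> b s) =
         (LINT t|lebesgue_on {0..T}. a t \<bullet> integral {t..T} b)"
proof -
  define M where "M = lebesgue_on {0..T}"
  have fin: "finite_measure M" unfolding M_def by (rule finite_measure_lebesgue_on) simp
  interpret finite_measure M by (rule fin)
  interpret pair_sigma_finite M M ..
  have sp: "space M = {0..T}" by (simp add: M_def)
  have ia: "integrable M a" and ib: "integrable M b"
    using a b unfolding M_def by (auto intro: absolutely_integrable_imp_integrable)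
  note [measurable] = borel_measurable_integrable[OF ia] borel_measurable_integrable[OF ib]
  have [measurable]: "(\<lambda>x. x) \<in> borel_measurable M"
    unfolding M_def by (rule measurable_restrict_space1) (simp add: measurable_completion)
  define F where "F t s = (if t \<le> s then a t \<bullet> b s else 0)" for t s
  have Fm: "case_prod F \<in> borel_measurable (M \<Otimes>\<^sub>M M)"
    unfolding F_def case_prod_beta by measurable
  have "integrable (M \<Otimes>\<^sub>M M) (case_prod F)"
  proof (rule Bochner_Integration.integrable_bound[OF _ Fm])
    show "integrable (M \<Otimes>\<^sub>M M) (\<lambda>(t, s). norm (a t) * norm (b s))"
      by (rule Fubini_integrable) (use ia ib in \<open>auto simp: abs_mult\<close>)
    show "AE p in M \<Otimes>\<^sub>M M. norm (case_prod F p) \<le> norm (case p of (t, s) \<Rightarrow> norm (a t) * norm (b s))"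
      by (auto simp: F_def Cauchy_Schwarz_ineq2)
  qed
  then have "(LINT s|M. LINT t|M. F t s) = (LINT t|M. LINT s|M. F t s)"
    by (rule Fubini_integral)
  moreover have "(LINT t|M. F t s) = integral {0..s} a \<bullet> b s" if "s \<in> space M" for s
  proof -
    have sub: "a absolutely_integrable_on {0..s}"
      using that by (intro set_integrable_subset[OF a]) (auto simp: sp)
    have "(LINT t|M. F t s) = (LINT t|lebesgue. (indicator {0..s} t *\<^sub>R a t) \<bullet> b s)"
      unfolding M_def using that
      by (subst integral_restrict_space)
        (auto intro!: Bochner_Integration.integral_cong simp: F_def sp indicator_def)
    also have "\<dots> = (LINT t:{0..s}|lebesgue. a t) \<bullet> b s"
      using sub unfolding set_lebesgue_integral_def set_integrable_def
      by (intro integral_inner_left) auto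
    finally show ?thesis by (simp add: set_lebesgue_integral_eq_integral[OF sub])
  qed
  moreover have "(LINT s|M. F t s) = a t \<bullet> integral {t..T} b" if "t \<in> space M" for t
  proof -
    have sub: "b absolutely_integrable_on {t..T}"
      using that by (intro set_integrable_subset[OF b]) (auto simp: sp)
    have "(LINT s|M. F t s) = (LINT s|lebesgue. a t \<bullet> (indicator {t..T} s *\<^sub>R b s))"
      unfolding M_def using that
      by (subst integral_restrict_space)
        (auto intro!: Bochner_Integration.integral_cong simp: F_def sp indicator_def)
    also have "\<dots> = a t \<bullet> (LINT s:{t..T}|lebesgue. b s)"
      using sub unfolding set_lebesgue_integral_def set_integrable_def
      by (intro integral_inner_right) auto
    finally show ?thesis by (simp add: set_lebesgue_integral_eq_integral[OF sub])
  qed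
  ultimately show ?thesis
    unfolding M_def[symmetric] by (simp cong: Bochner_Integration.integral_cong)
qed

text \<open>Trajectories live on the closed interval and elements of \<open>L\<^sup>2\<close> on the open one; the next three
lemmas make the transition between the two invisible.\<close>

lemma integrable_lebesgue_on_Icc_iff_Ioo:
  fixes f :: "real \<Rightarrow> 'a::euclidean_space"
  shows "integrable (lebesgue_on {a..b}) f \<longleftrightarrow> integrable (lebesgue_on {a<..<b}) f"
proof -
  have "negligible ({a..b} - {a<..<b})"
    by (rule negligible_subset[of "{a,b}"]) auto
  then have "negligible {x \<in> {a..b} - {a<..<b}. f x \<noteq> 0}"
    by (rule negligible_subset) auto
  then have "f absolutely_integrable_on {a..b} \<longleftrightarrow> f absolutely_integrable_on {a<..<b}"
    by (intro absolutely_integrable_spike_set_eq) (auto intro: negligible_subset[of "{}"])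
  then show ?thesis by (simp add: integrable_restrict_space set_integrable_def)
qed

lemma integral_lebesgue_on_Icc_eq_Ioo:
  fixes f :: "real \<Rightarrow> 'a::euclidean_space"
  shows "integral\<^sup>L (lebesgue_on {a..b}) f = integral\<^sup>L (lebesgue_on {a<..<b}) f"
proof (cases "integrable (lebesgue_on {a..b}) f")
  case True
  then have "integrable (lebesgue_on {a<..<b}) f" by (simp add: integrable_lebesgue_on_Icc_iff_Ioo)
  with True show ?thesis
    by (simp add: lebesgue_integral_eq_integral integral_open_interval_real)
next
  case False
  then show ?thesis
    by (simp add: not_integrable_integral_eq integrable_lebesgue_on_Icc_iff_Ioo)
qed

lemma AE_lebesgue_on_Icc_iff_Ioo:
  "(AE t in lebesgue_on {a..b::real}. P t) \<longleftrightarrow> (AE t in lebesgue_on {a<..<b}. P t)"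
proof -
  have "AE t in lebesgue. t \<noteq> a \<and> t \<noteq> b"
    using AE_lborel_singleton[of a] AE_lborel_singleton[of b]
    by (auto intro!: AE_completion elim: AE_mp)
  then have "(AE t in lebesgue. t \<in> {a..b} \<longrightarrow> P t) \<longleftrightarrow> (AE t in lebesgue. t \<in> {a<..<b} \<longrightarrow> P t)"
    by (intro iffI; elim AE_mp; intro AE_I2) auto
  then show ?thesis by (simp add: AE_restrict_space_iff)
qed

lemma L2_iff_square_integrable: "f \<in> L2 T \<longleftrightarrow> square_integrable (lebesgue_on {0<..<T}) f"
  by (simp add: L2_def square_integrable_def)

lemma finite_measure_lebesgue_on_Ioo: "finite_measure (lebesgue_on {a<..<b::real})"
  by (rule finite_measure_lebesgue_on) simp

lemma (in finite_measure) square_integrable_imp_integrable: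
  assumes "square_integrable M f"
  shows "integrable M f"
proof (rule Bochner_Integration.integrable_bound)
  show "integrable M (\<lambda>x. 1 + (norm (f x))\<^sup>2)" using assms by (simp add: square_integrable_def)
  have "y \<le> 1 + y\<^sup>2" for y :: real
    using zero_le_power2[of "y - 1/2"] by (simp add: power2_eq_square algebra_simps)
  then show "AE x in M. norm (f x) \<le> norm (1 + (norm (f x))\<^sup>2)" by (simp add: add_nonneg_nonneg)
qed (use assms in \<open>simp add: square_integrable_def\<close>)

lemma L2_imp_absolutely_integrable:
  assumes "f \<in> L2 T"
  shows "f absolutely_integrable_on {0..T}"
proof -
  have "integrable (lebesgue_on {0<..<T}) f"
    using finite_measure.square_integrable_imp_integrable[OF finite_measure_lebesgue_on_Ioo] assms
    by (simp add: L2_iff_square_integrable)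
  then have "integrable (lebesgue_on {0..T}) f" by (simp add: integrable_lebesgue_on_Icc_iff_Ioo)
  then show ?thesis by (simp add: integrable_restrict_space set_integrable_def)
qed

lemma continuous_on_imp_L2:
  fixes f :: "real \<Rightarrow> 'a::euclidean_space"
  assumes "continuous_on {0..T} f"
  shows "f \<in> L2 T"
proof -
  have "integrable (lebesgue_on {0<..<T}) f"
    unfolding integrable_lebesgue_on_Icc_iff_Ioo[symmetric]
    by (intro absolutely_integrable_imp_integrable absolutely_integrable_continuous_real assms) simp
  moreover have "continuous_on {0..T} (\<lambda>t. (norm (f t))\<^sup>2)" by (intro continuous_intros assms)
  then have "integrable (lebesgue_on {0<..<T}) (\<lambda>t. (norm (f t))\<^sup>2)"
    unfolding integrable_lebesgue_on_Icc_iff_Ioo[symmetric]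
    by (intro absolutely_integrable_imp_integrable absolutely_integrable_continuous_real) simp_all
  ultimately show ?thesis by (auto simp: L2_def)
qed

lemma L2_matrix_vector_mult:
  fixes M :: "real^'k^'l"
  shows "f \<in> L2 T \<Longrightarrow> (\<lambda>t. M *v f t) \<in> L2 T"
  unfolding L2_iff_square_integrable
  by (rule square_integrable_linear[OF _ matrix_vector_mul_linear])

lemma inner_matrix_vector_mult:
  fixes M :: "real^'k^'l"
  shows "(M *v x) \<bullet> y = x \<bullet> (transpose M *v y)"
  by (metis dot_lmul_matrix vector_transpose_matrix transpose_transpose)

text \<open>The adjoint of the input-output map \<open>u \<mapsto> C x\<close> is \<open>g \<mapsto> B\<^sup>T \<phi>\<close>. This is integration by parts for
\<open>x \<bullet> \<phi>\<close>, whose boundary terms vanish since \<open>x 0 = 0\<close> and \<open>\<phi> T = 0\<close>; the two terms that contain \<open>A\<close>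
cancel.\<close>

lemma input_output_duality:
  fixes A :: "real^'n^'n" and B :: "real^'m^'n" and C :: "real^'n^'p"
  assumes T: "0 \<le> T" and u: "u \<in> L2 T" and g: "g \<in> L2 T"
    and x: "state_trajectory T A B u x" and phi: "adjoint_trajectory T A C g \<phi>"
  shows "(LINT t|lebesgue_on {0<..<T}. (C *v x t) \<bullet> g t) =
         (LINT t|lebesgue_on {0<..<T}. u t \<bullet> (transpose B *v \<phi> t))"
proof -
  define M where "M = lebesgue_on {0<..<T}"
  define a where "a = (\<lambda>t. A *v x t + B *v u t)"
  define b where "b = (\<lambda>t. - (transpose A *v \<phi> t + transpose C *v g t))"
  have ai: "a absolutely_integrable_on {0..T}"
    and xa: "\<And>t. t \<in> {0..T} \<Longrightarrow> x t = integral {0..t} a"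
    using x unfolding state_trajectory_def solves_on_iff a_def by auto
  have bi: "b absolutely_integrable_on {0..T}"
    and pb: "\<And>t. t \<in> {0..T} \<Longrightarrow> \<phi> t = \<phi> 0 + integral {0..t} b" and pT: "\<phi> T = 0"
    using phi unfolding adjoint_trajectory_def solves_on_iff b_def by blast+
  have pb': "\<phi> t = - integral {t..T} b" if t: "t \<in> {0..T}" for t
  proof -
    have "integral {0..t} b + integral {t..T} b = integral {0..T} b"
      using bi t by (intro Henstock_Kurzweil_Integration.integral_combine)
        (auto simp: absolutely_integrable_on_def)
    moreover have "\<phi> 0 + integral {0..T} b = 0" using pb[of T] pT T by simp
    ultimately have "\<phi> 0 + integral {0..t} b + integral {t..T} b = 0" by (simp add: add.assoc)
    then show ?thesis using pb[OF t] by (simp add: eq_neg_iff_add_eq_0)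
  qed
  have L: "x \<in> L2 T" "\<phi> \<in> L2 T" 
    using x phi unfolding state_trajectory_def adjoint_trajectory_def
    by (auto intro: continuous_on_imp_L2 solves_on_continuous)
  have I: "integrable M (\<lambda>t. p t \<bullet> q t)" if "p \<in> L2 T" "q \<in> L2 T" for p q :: "real \<Rightarrow> real^'k"
    using that unfolding M_def L2_iff_square_integrable by (rule integrable_inner_square_integrable)
  have I1: "integrable M (\<lambda>t. (A *v x t) \<bullet> \<phi> t)" by (intro I L2_matrix_vector_mult L)
  have I2: "integrable M (\<lambda>t. (C *v x t) \<bullet> g t)" by (intro I L2_matrix_vector_mult L g)
  have I3: "integrable M (\<lambda>t. u t \<bullet> (transpose B *v \<phi> t))" by (intro I L2_matrix_vector_mult L u)
  have "(LINT t|M. (A *v x t) \<bullet> \<phi> t) + (LINT t|M. (C *v x t) \<bullet> g t)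
      = (LINT t|M. - (x t \<bullet> b t))"
    unfolding Bochner_Integration.integral_add[OF I1 I2, symmetric] b_def
    by (intro Bochner_Integration.integral_cong) (simp_all add: inner_matrix_vector_mult inner_simps)
  also have "\<dots> = - (LINT t|lebesgue_on {0..T}. x t \<bullet> b t)"
    by (simp add: M_def integral_lebesgue_on_Icc_eq_Ioo)
  also have "(LINT t|lebesgue_on {0..T}. x t \<bullet> b t) = (LINT t|lebesgue_on {0..T}. integral {0..t} a \<bullet> b t)"
    by (intro Bochner_Integration.integral_cong) (simp_all add: xa)
  also have "\<dots> = (LINT t|lebesgue_on {0..T}. a t \<bullet> integral {t..T} b)"
    by (rule integration_by_parts_indefinite_integrals[OF ai bi])
  also have "\<dots> = (LINT t|lebesgue_on {0..T}. - (a t \<bullet> \<phi> t))"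
    by (intro Bochner_Integration.integral_cong) (simp_all add: pb')
  also have "- \<dots> = (LINT t|M. a t \<bullet> \<phi> t)"
    by (simp add: M_def integral_lebesgue_on_Icc_eq_Ioo)
  also have "\<dots> = (LINT t|M. (A *v x t) \<bullet> \<phi> t) + (LINT t|M. u t \<bullet> (transpose B *v \<phi> t))"
    unfolding Bochner_Integration.integral_add[OF I1 I3, symmetric] a_def
    by (intro Bochner_Integration.integral_cong) (simp_all add: inner_matrix_vector_mult[of B] inner_simps)
  finally show ?thesis by (simp add: M_def)
qed

section \<open>Controllability and unique continuation\<close>

lemma state_trajectory_exists:
  fixes A :: "real^'n^'n" and B :: "real^'m^'n"
  assumes "0 \<le> T" "u \<in> L2 T"
  obtains x where "state_trajectory T A B u x"
  using initial_value_problem_solution[OF assms(1) matrix_vector_mul_bounded_linear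
      L2_imp_absolutely_integrable[OF L2_matrix_vector_mult[OF assms(2)]]]
  unfolding state_trajectory_def by metis

lemma adjoint_trajectory_exists:
  fixes A :: "real^'n^'n" and C :: "real^'n^'p"
  assumes "0 \<le> T" "g \<in> L2 T"
  obtains \<phi> where "adjoint_trajectory T A C g \<phi>"
  using terminal_value_problem_solution[OF assms(1) matrix_vector_mul_bounded_linear
      L2_imp_absolutely_integrable[OF L2_matrix_vector_mult[OF assms(2)]]]
  unfolding adjoint_trajectory_def by metis

lemma output_in_L2:
  assumes "state_trajectory T A B u x"
  shows "(\<lambda>t. C *v x t) \<in> L2 T"
  using assms unfolding state_trajectory_def
  by (intro L2_matrix_vector_mult continuous_on_imp_L2 solves_on_continuous) auto

lemma state_trajectory_lincomb:
  fixes A :: "real^'n^'n" and B :: "real^'m^'n"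
  assumes "state_trajectory T A B u x" "state_trajectory T A B v y"
  shows "state_trajectory T A B (\<lambda>t. c *\<^sub>R u t + v t) (\<lambda>t. c *\<^sub>R x t + y t)"
proof -
  define a where "a = (\<lambda>t. A *v x t + B *v u t)"
  define b where "b = (\<lambda>t. A *v y t + B *v v t)"
  have ab: "a absolutely_integrable_on {0..T}" "b absolutely_integrable_on {0..T}"
    and xy: "\<And>t. t \<in> {0..T} \<Longrightarrow> x t = integral {0..t} a" "\<And>t. t \<in> {0..T} \<Longrightarrow> y t = integral {0..t} b"
    and 0: "x 0 = 0" "y 0 = 0"
    using assms unfolding state_trajectory_def solves_on_iff a_def b_def by auto
  have eq: "A *v (c *\<^sub>R x t + y t) + B *v (c *\<^sub>R u t + v t) = c *\<^sub>R a t + b t" for t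
    by (simp add: a_def b_def matrix_vector_right_distrib matrix_vector_mult_scaleR scaleR_add_right)
  have "c *\<^sub>R x t + y t = integral {0..t} (\<lambda>s. c *\<^sub>R a s + b s)" if t: "t \<in> {0..T}" for t
  proof -
    have "a integrable_on {0..t}" "b integrable_on {0..t}"
      using ab t unfolding absolutely_integrable_on_def
      by (auto intro: integrable_subinterval_real)
    then show ?thesis using xy t by (simp add: integral_add integrable_cmul)
  qed
  moreover have "(\<lambda>s. c *\<^sub>R a s + b s) absolutely_integrable_on {0..T}"
    using ab by (intro set_integral_add(1) absolutely_integrable_scaleR_left)
  ultimately show ?thesis
    unfolding state_trajectory_def solves_on_iff eq using 0 by auto
qed

text \<open>The hypothesis is phrased with arbitrary \<open>\<epsilon>\<close> because the approximation property supplies its bounds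
one tolerance at a time.\<close>

lemma AE_zero_of_integral_norm_sq_le:
  assumes g: "square_integrable M g"
    and small: "\<And>\<epsilon>. \<epsilon> > 0 \<Longrightarrow> (LINT t|M. (norm (g t))\<^sup>2) \<le> \<epsilon>"
  shows "AE t in M. g t = 0"
proof -
  have "(LINT t|M. (norm (g t))\<^sup>2) \<le> 0" by (rule field_le_epsilon) (simp add: small)
  moreover have "0 \<le> (LINT t|M. (norm (g t))\<^sup>2)" by (intro integral_nonneg_AE) auto
  ultimately have "(LINT t|M. (norm (g t))\<^sup>2) = 0" by linarith
  then show ?thesis
    using integral_nonneg_eq_0_iff_AE[of M "\<lambda>t. (norm (g t))\<^sup>2"] g
    by (simp add: square_integrable_def)
qed

text \<open>If \<open>B\<^sup>T \<phi> = 0\<close>, then by duality \<open>g\<close> is orthogonal to every output. By Pythagoras no output is then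
closer to \<open>g\<close> than \<open>0\<close> is, whereas outputs come arbitrarily close to \<open>g\<close> by assumption.\<close>

lemma controllable_imp_unique_continuation:
  fixes A :: "real^'n^'n" and B :: "real^'m^'n" and C :: "real^'n^'p"
  assumes T: "0 \<le> T" and ctrl: "approx_output_tracking_controllable T A B C"
  shows "unique_continuation_property T A B C"
  unfolding unique_continuation_property_def
proof (intro ballI allI impI)
  fix g :: "real \<Rightarrow> real^'p" and \<phi>
  assume g: "g \<in> L2 T" and phi: "adjoint_trajectory T A C g \<phi>"
    and B0: "AE t in lebesgue_on {0..T}. transpose B *v \<phi> t = 0"
  define M where "M = lebesgue_on {0<..<T}"
  have B0': "AE t in M. transpose B *v \<phi> t = 0"
    using B0 unfolding M_def AE_lebesgue_on_Icc_iff_Ioo .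
  have sg: "square_integrable M g" using g by (simp add: M_def L2_iff_square_integrable)
  have "(LINT t|M. (norm (g t))\<^sup>2) \<le> e" if "e > 0" for e
  proof -
    have "sqrt e > 0" using that by simp
    then obtain u x where u: "u \<in> L2 T" and x: "state_trajectory T A B u x"
      and le: "L2_norm T (\<lambda>t. C *v x t - g t) \<le> sqrt e"
      using ctrl g unfolding approx_output_tracking_controllable_def by meson
    have sC: "square_integrable M (\<lambda>t. C *v x t)"
      using output_in_L2[OF x] by (simp add: M_def L2_iff_square_integrable)
    have "(LINT t|M. (C *v x t) \<bullet> g t) = (LINT t|M. u t \<bullet> (transpose B *v \<phi> t))"
      unfolding M_def by (rule input_output_duality[OF T u g x phi])
    also have "\<dots> = 0"
      by (rule integral_eq_zero_AE) (use B0' in \<open>auto elim!: eventually_mono\<close>)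
    finally have orth: "(LINT t|M. (C *v x t) \<bullet> g t) = 0" .
    have "(LINT t|M. (norm (g t))\<^sup>2) \<le> (LINT t|M. (norm (C *v x t))\<^sup>2) + (LINT t|M. (norm (g t))\<^sup>2)"
      by (simp add: integral_nonneg_AE)
    also have "\<dots> = (LINT t|M. (norm (C *v x t - g t))\<^sup>2)"
      using integral_norm_sq_add[OF sC sg, of "-1"] orth by simp
    also have "\<dots> \<le> e" using le by (simp add: L2_norm_def M_def)
    finally show ?thesis .
  qed
  with sg show "AE t in lebesgue_on {0<..<T}. g t = 0"
    unfolding M_def[symmetric] by (rule AE_zero_of_integral_norm_sq_le)
qed

text \<open>Let \<open>g\<close> be the component of the target \<open>f\<close> orthogonal to all outputs. Steering the system with the
particular control \<open>u = B\<^sup>T \<phi>\<close>, where \<open>\<phi>\<close> is the adjoint trajectory driven by \<open>g\<close>, turns the duality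
identity into a formula for the squared norm of \<open>u\<close>, which must therefore vanish. Unique continuation
gives \<open>g = 0\<close>, so \<open>f\<close> lies in the closure of the outputs.\<close>

lemma unique_continuation_imp_controllable:
  fixes A :: "real^'n^'n" and B :: "real^'m^'n" and C :: "real^'n^'p"
  assumes T: "0 \<le> T" and ucp: "unique_continuation_property T A B C"
  shows "approx_output_tracking_controllable T A B C"
  unfolding approx_output_tracking_controllable_def
proof (intro ballI allI impI)
  fix f :: "real \<Rightarrow> real^'p" and \<epsilon> :: real
  assume f: "f \<in> L2 T" and e: "\<epsilon> > 0"
  define M where "M = lebesgue_on {0<..<T}"
  define V where "V = {(\<lambda>t. C *v x t) | u x. u \<in> L2 T \<and> state_trajectory T A B u x}"
  interpret finite_measure M unfolding M_def by (rule finite_measure_lebesgue_on_Ioo)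
  note L2M = L2_iff_square_integrable[of _ T, folded M_def]
  have zero: "state_trajectory T A B (\<lambda>_. 0) (\<lambda>_. 0)"
    by (simp add: state_trajectory_def solves_on_def set_integrable_def)
  have zeroL: "(\<lambda>_. 0::real^'m) \<in> L2 T" by (intro continuous_on_imp_L2) simp
  have lin: "(\<lambda>t. c *\<^sub>R v t + w t) \<in> V" if vV: "v \<in> V" and wV: "w \<in> V" for c v w
  proof -
    obtain u x where u: "u \<in> L2 T" "state_trajectory T A B u x" "v = (\<lambda>t. C *v x t)"
      using vV by (auto simp: V_def)
    obtain u' x' where u': "u' \<in> L2 T" "state_trajectory T A B u' x'" "w = (\<lambda>t. C *v x' t)"
      using wV by (auto simp: V_def)
    have "(\<lambda>t. c *\<^sub>R u t + u' t) \<in> L2 T"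
      using u(1) u'(1) unfolding L2M by (intro square_integrable_add square_integrable_scaleR)
    moreover have "(\<lambda>t. c *\<^sub>R v t + w t) = (\<lambda>t. C *v (c *\<^sub>R x t + x' t))"
      by (simp add: u u' matrix_vector_right_distrib matrix_vector_mult_scaleR)
    moreover note state_trajectory_lincomb[OF u(2) u'(2), of c]
    ultimately show ?thesis unfolding V_def mem_Collect_eq by (intro exI conjI)
  qed
  have V0: "(\<lambda>_. 0) \<in> V"
    unfolding V_def using zero zeroL by (auto intro!: exI[of _ "\<lambda>_. 0"])
  have VL: "square_integrable M v" if "v \<in> V" for v
    using that output_in_L2 unfolding V_def L2M[symmetric] by blast
  have sf: "square_integrable M f" using f by (simp add: L2M)
  obtain w where w: "square_integrable M w"
    and orth: "\<And>v. v \<in> V \<Longrightarrow> (LINT t|M. (f t - w t) \<bullet> v t) = 0"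
    and near: "\<And>e. e > 0 \<Longrightarrow> \<exists>v\<in>V. (LINT t|M. (norm (v t - w t))\<^sup>2) \<le> e"
    using square_integrable_projection[of V f] VL V0 lin[of _ _ 1] lin[OF _ V0] sf by auto
  define g where "g = (\<lambda>t. f t - w t)"
  have g: "g \<in> L2 T" unfolding g_def L2M by (intro square_integrable_diff sf w)
  obtain \<phi> where phi: "adjoint_trajectory T A C g \<phi>"
    by (rule adjoint_trajectory_exists[OF T g])
  define u where "u = (\<lambda>t. transpose B *v \<phi> t)"
  have u: "u \<in> L2 T"
    using phi unfolding u_def adjoint_trajectory_def
    by (intro L2_matrix_vector_mult continuous_on_imp_L2 solves_on_continuous) auto
  obtain x where x: "state_trajectory T A B u x" by (rule state_trajectory_exists[OF T u])
  have "(LINT t|M. (norm (u t))\<^sup>2) = (LINT t|M. (C *v x t) \<bullet> g t)"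
    using input_output_duality[OF T u g x phi] by (simp add: u_def M_def power2_norm_eq_inner)
  also have "\<dots> = 0"
    using orth[of "\<lambda>t. C *v x t"] u x by (auto simp: V_def g_def inner_commute)
  finally have "AE t in M. u t = 0"
    using u by (intro AE_zero_of_integral_norm_sq_le) (auto simp: L2M)
  then have "AE t in lebesgue_on {0..T}. transpose B *v \<phi> t = 0"
    unfolding AE_lebesgue_on_Icc_iff_Ioo M_def u_def .
  then have g0: "AE t in M. g t = 0"
    using ucp g phi unfolding unique_continuation_property_def M_def by blast
  have "\<epsilon>\<^sup>2 > 0" using e by simp
  then obtain v where v: "v \<in> V" and le: "(LINT t|M. (norm (v t - w t))\<^sup>2) \<le> \<epsilon>\<^sup>2"
    using near by blast
  from v obtain u' x' where u': "u' \<in> L2 T" "state_trajectory T A B u' x'" "v = (\<lambda>t. C *v x' t)"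
    by (auto simp: V_def)
  have [measurable]: "v \<in> borel_measurable M" "w \<in> borel_measurable M" "f \<in> borel_measurable M"
    using VL[OF v] w sf by (auto simp: square_integrable_def)
  have "(LINT t|M. (norm (v t - f t))\<^sup>2) = (LINT t|M. (norm (v t - w t))\<^sup>2)"
    by (rule integral_cong_AE) (use g0 in \<open>auto simp: g_def elim!: eventually_mono\<close>)
  with le have "L2_norm T (\<lambda>t. C *v x' t - f t) \<le> \<epsilon>"
    using e by (simp add: L2_norm_def M_def u'(3) real_le_lsqrt)
  with u' show "\<exists>u\<in>L2 T. \<exists>x. state_trajectory T A B u x \<and> L2_norm T (\<lambda>t. C *v x t - f t) \<le> \<epsilon>"
    by blast
qed

theorem theorem4p3:
  fixes T :: real
    and A :: "real^'n^'n" and B :: "real^'m^'n" and C :: "real^'n^'p"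
  assumes "T > 0"
    and "CARD('m) \<le> CARD('n)" and "CARD('p) \<le> CARD('n)"
    and "rank C = CARD('p)"
  shows "approx_output_tracking_controllable T A B C \<longleftrightarrow> unique_continuation_property T A B C"
  using assms(1) controllable_imp_unique_continuation unique_continuation_imp_controllable
  by (metis less_imp_le)

end
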